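(* Let $X$ be a complex Banach space, $\alpha>0$, and $T\in\mathcal{B}(X)$ a $(C,\alpha)$-bounded operator with $\sigma(T)\cap\mathbb{T}\subseteq\{1\}$. Then $$\lim_{n\to\infty}\|M_T^\alpha(n+1)-M_T^\alpha(n)\|=0.$$
   Context: $\mathbb{T}$ is the unit circle in $\mathbb{C}$, $\sigma(T)$ the spectrum. For $\alpha>0$, $k^\alpha(n)=\frac{\Gamma(n+\alpha)}{\Gamma(\alpha)\Gamma(n+1)}$, $n\in\mathbb{N}_0$. $\Delta^{-\alpha}\mathcal{T}(n)=\sum_{j=0}^nk^\alpha(n-j)T^j$, $M_T^\alpha(n)=\Delta^{-\alpha}\mathcal{T}(n)/k^{\alpha+1}(n)$; $T$ is $(C,\alpha)$-bounded if $\sup_n\|M_T^\alpha(n)\|<\infty$. *)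

theory Defs
  imports "HOL-Analysis.Analysis"
begin

class complex_vector = real_vector +
  fixes scaleC :: "complex \<Rightarrow> 'a \<Rightarrow> 'a"
  assumes scaleC_add_right: "scaleC a (x + y) = scaleC a x + scaleC a y"
    and scaleC_add_left: "scaleC (a + b) x = scaleC a x + scaleC b x"
    and scaleC_scaleC: "scaleC a (scaleC b x) = scaleC (a * b) x"
    and scaleC_one: "scaleC 1 x = x"
    and scaleR_scaleC: "scaleR r x = scaleC (complex_of_real r) x"

class complex_normed_vector = complex_vector + real_normed_vector +
  assumes norm_scaleC: "norm (scaleC a x) = cmod a * norm x"

definition clinear_op :: "('a::complex_normed_vector \<Rightarrow>\<^sub>L 'a) \<Rightarrow> bool" where
  "clinear_op T \<longleftrightarrow> (\<forall>c x. blinfun_apply T (scaleC c x) = scaleC c (blinfun_apply T x))"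

definition cspectrum :: "('a::complex_normed_vector \<Rightarrow>\<^sub>L 'a) \<Rightarrow> complex set" where
  "cspectrum T = {l. \<not> (\<exists>S. clinear_op S \<and>
       (\<forall>x. blinfun_apply S (scaleC l x - blinfun_apply T x) = x) \<and>
       (\<forall>x. scaleC l (blinfun_apply S x) - blinfun_apply T (blinfun_apply S x) = x))}"

definition blpow :: "('a::real_normed_vector \<Rightarrow>\<^sub>L 'a) \<Rightarrow> nat \<Rightarrow> ('a \<Rightarrow>\<^sub>L 'a)" where
  "blpow T n = ((\<lambda>S. T o\<^sub>L S) ^^ n) id_blinfun"

definition kcoef :: "real \<Rightarrow> nat \<Rightarrow> real" where
  "kcoef a n = Gamma (real n + a) / (Gamma a * Gamma (real n + 1))"

definition cesaro_sum :: "real \<Rightarrow> ('a::real_normed_vector \<Rightarrow>\<^sub>L 'a) \<Rightarrow> nat \<Rightarrow> ('a \<Rightarrow>\<^sub>L 'a)" where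
  "cesaro_sum a T n = (\<Sum>j=0..n. kcoef a (n - j) *\<^sub>R blpow T j)"

definition cesaro_mean :: "real \<Rightarrow> ('a::real_normed_vector \<Rightarrow>\<^sub>L 'a) \<Rightarrow> nat \<Rightarrow> ('a \<Rightarrow>\<^sub>L 'a)" where
  "cesaro_mean a T n = (1 / kcoef (a + 1) n) *\<^sub>R cesaro_sum a T n"

definition cesaro_bounded :: "real \<Rightarrow> ('a::real_normed_vector \<Rightarrow>\<^sub>L 'a) \<Rightarrow> bool" where
  "cesaro_bounded a T \<longleftrightarrow> (\<exists>C. \<forall>n. norm (cesaro_mean a T n) \<le> C)"

end

theory Submission
  imports Defs
begin

text \<open>
  The Cesaro means satisfy \<open>T M(n) - M(n+1) = a/(n+1) (M(n+1) - I) \<rightarrow> 0\<close>, so it suffices to show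
  \<open>(T - I) M(n) \<rightarrow> 0\<close>. Put \<open>q A = limsup \<parallel>A M(n)\<parallel>\<close>. This is a seminorm with \<open>q (A T) = q A\<close>
  and \<open>q (S A) \<le> \<parallel>S\<parallel> q A\<close>, and one has to show \<open>q (T - I) = 0\<close>, a Katznelson-Tzafriri theorem.

  Let \<open>n = r m\<close> and sample the function \<open>z - 1\<close> at the roots of unity of order \<open>2n + 1\<close>. Split it into
  a part with Fourier coefficients of \<open>\<ell>\<^sup>1\<close>-norm at most \<open>24/m\<close> and a part \<open>h\<close> vanishing at the
  roots close to 1. In a Fejer average of the powers of \<open>T\<close>, the first part contributes at most
  \<open>24 q(I)/m\<close>. The second part is a sum of squares of the geometric sums \<open>\<Sum>i<n. w\<^sup>-\<^sup>i T\<^sup>i\<close> with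
  \<open>w\<close> on the unit circle away from 1. As \<open>w - T\<close> is invertible there, with inverses bounded by
  compactness, their seminorms are bounded independently of \<open>n\<close>, and averaging gains a factor
  \<open>1/n\<close>. Let first \<open>r\<close> and then \<open>m\<close> tend to infinity.
\<close>

section \<open>A finite Fourier decomposition\<close>

text \<open>The odd order makes \<open>-n..n\<close> a complete residue system symmetric about 0. It
  indexes the roots and, on the dual side, the Fourier coefficients.\<close>

definition unity_root :: "nat \<Rightarrow> int \<Rightarrow> complex" where
  "unity_root n k = cis (2 * pi * of_int k / (2 * real n + 1))"

lemma unity_root_add: "unity_root n (k + l) = unity_root n k * unity_root n l"
  by (simp add: unity_root_def cis_mult add_divide_distrib distrib_left)

lemma unity_root_0 [simp]: "unity_root n 0 = 1"
  by (simp add: unity_root_def)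

lemma norm_unity_root [simp]: "norm (unity_root n k) = 1"
  by (simp add: unity_root_def)

lemma cnj_unity_root: "cnj (unity_root n k) = unity_root n (- k)"
  by (simp add: unity_root_def cis_cnj)

lemma unity_root_inverse: "unity_root n (- k) = inverse (unity_root n k)"
  by (simp add: unity_root_def)

lemma unity_root_mult_nat: "unity_root n (k * int j) = unity_root n k ^ j"
  by (simp add: unity_root_def Complex.DeMoivre mult_ac)

lemma unity_root_eq_1_imp_dvd:
  assumes "unity_root n k = 1"
  shows "2 * int n + 1 dvd k"
proof -
  have "cos (2 * pi * of_int k / (2 * real n + 1)) = 1"
    using assms by (simp add: unity_root_def complex_eq_iff)
  then obtain m :: int where "2 * pi * of_int k / (2 * real n + 1) = of_int m * 2 * pi"
    by (auto simp: cos_one_2pi_int)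
  then have "2 * pi * of_int k = of_int m * 2 * pi * (2 * real n + 1)"
    by (subst (asm) nonzero_divide_eq_eq) linarith+
  then have "(2 * pi) * of_int k = (2 * pi) * (of_int m * (2 * real n + 1))"
    by (simp add: mult_ac)
  then have "real_of_int k = of_int m * (2 * real n + 1)"
    by (subst (asm) mult_cancel_left) simp
  then have "real_of_int k = of_int (m * (2 * int n + 1))"
    by simp
  then have "k = m * (2 * int n + 1)"
    by (simp only: of_int_eq_iff)
  then show ?thesis by simp
qed

lemma unity_root_period: "unity_root n (k + (2 * int n + 1) * l) = unity_root n k"
proof -
  have "2 * real n + 1 \<noteq> 0" by linarith
  then have "2 * pi * of_int ((2 * int n + 1) * l) / (2 * real n + 1) = 2 * pi * of_int l"
    by (subst nonzero_divide_eq_eq) (simp_all add: mult_ac)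
  then have "unity_root n ((2 * int n + 1) * l) = cis (2 * pi * of_int l)"
    by (simp only: unity_root_def)
  also have "\<dots> = 1"
    by (rule cis_multiple_2pi) simp
  finally show ?thesis by (simp add: unity_root_add)
qed

text \<open>Multiplication by \<open>unity_root n k\<close> shifts the summation by one, which
  periodicity undoes. So the sum vanishes unless that root is 1, and in the given range 0 is the
  only multiple of \<open>2 * n + 1\<close>.\<close>

lemma sum_unity_root:
  assumes "\<bar>k\<bar> \<le> 2 * int n"
  shows "(\<Sum>l=-int n..int n. unity_root n (k * l)) = (if k = 0 then 2 * of_nat n + 1 else 0)"
proof (cases "k = 0")
  case True
  then show ?thesis by simp
next
  case False
  have ne: "unity_root n k \<noteq> 1"
    using unity_root_eq_1_imp_dvd[of n k] False assms zdvd_imp_le[of "2 * int n + 1" "\<bar>k\<bar>"] by auto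
  let ?f = "\<lambda>l. unity_root n (k * l)"
  have per: "?f (- int n) = ?f (int n + 1)"
    using unity_root_period[of n "k * (- int n)" k] by (simp add: algebra_simps)
  have "(\<Sum>l=-int n..int n. ?f l) * unity_root n k = (\<Sum>l=-int n..int n. ?f (l + 1))"
    by (simp add: sum_distrib_right distrib_left unity_root_add)
  also have "\<dots> = (\<Sum>l=-int n+1..int n+1. ?f l)"
    by (rule sum.reindex_bij_witness[of _ "\<lambda>l. l - 1" "\<lambda>l. l + 1"]) auto
  also have "{-int n+1..int n+1} = insert (int n + 1) {-int n+1..int n}"
    by auto
  also have "sum ?f \<dots> = sum ?f (insert (- int n) {-int n+1..int n})"
    using per by simp
  also have "insert (- int n) {-int n+1..int n} = {-int n..int n}"
    by auto
  finally have "(\<Sum>l=-int n..int n. ?f l) * (unity_root n k - 1) = 0"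
    by (simp add: algebra_simps)
  with ne False show ?thesis by simp
qed

text \<open>Expanding the squares produces the frequencies \<open>i - j\<close>. They have modulus
  at most \<open>2 * n\<close>, the range of the orthogonality relation
  \<open>sum_unity_root\<close>, so only the diagonal survives.\<close>

lemma unity_root_parseval:
  fixes c :: "int \<Rightarrow> complex"
  assumes A: "A \<subseteq> {-int n..int n}"
  shows "(\<Sum>l=-int n..int n. (norm (\<Sum>j\<in>A. c j * unity_root n (- (j * l))))\<^sup>2)
    = (2 * real n + 1) * (\<Sum>j\<in>A. (norm (c j))\<^sup>2)"
proof -
  have fin: "finite A" using A finite_subset by blast
  have sq: "complex_of_real ((norm z)\<^sup>2) = z * cnj z" for z
    by (rule complex_norm_square)
  have "complex_of_real (\<Sum>l=-int n..int n. (norm (\<Sum>j\<in>A. c j * unity_root n (- (j * l))))\<^sup>2)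
    = (\<Sum>l=-int n..int n. (\<Sum>j\<in>A. c j * unity_root n (- (j * l))) *
         (\<Sum>i\<in>A. cnj (c i) * unity_root n (i * l)))"
    by (simp add: sq cnj_unity_root del: of_real_power)
  also have "\<dots> = (\<Sum>l=-int n..int n. \<Sum>j\<in>A. \<Sum>i\<in>A. c j * cnj (c i) * unity_root n ((i - j) * l))"
    unfolding sum_product
    by (intro sum.cong refl) (simp add: algebra_simps flip: unity_root_add)
  also have "\<dots> = (\<Sum>j\<in>A. \<Sum>i\<in>A. \<Sum>l=-int n..int n. c j * cnj (c i) * unity_root n ((i - j) * l))"
    by (subst sum.swap) (intro sum.cong refl sum.swap)
  also have "\<dots> = (\<Sum>j\<in>A. \<Sum>i\<in>A. c j * cnj (c i) * (if i = j then 2 * of_nat n + 1 else 0))"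
  proof (intro sum.cong refl)
    fix j i assume "j \<in> A" "i \<in> A"
    then have "j \<in> {-int n..int n}" "i \<in> {-int n..int n}" using A by auto
    then have "\<bar>i - j\<bar> \<le> 2 * int n" by auto
    from sum_unity_root[OF this]
    show "(\<Sum>l=-int n..int n. c j * cnj (c i) * unity_root n ((i - j) * l))
      = c j * cnj (c i) * (if i = j then 2 * of_nat n + 1 else 0)"
      by (simp flip: sum_distrib_left)
  qed
  also have "\<dots> = (\<Sum>j\<in>A. c j * cnj (c j) * (2 * of_nat n + 1))"
    using fin by (simp add: if_distrib cong: if_cong)
  also have "\<dots> = complex_of_real ((2 * real n + 1) * (\<Sum>j\<in>A. (norm (c j))\<^sup>2))"
    by (simp add: sq sum_distrib_left sum_distrib_right mult_ac del: of_real_power)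
  finally show ?thesis by (simp only: of_real_eq_iff)
qed

text \<open>The chord from 1 to \<open>cis x\<close> has length \<open>2 * |sin (x/2)|\<close>, at
  most the arc \<open>|x|\<close>.\<close>

lemma norm_unity_root_minus_1_le:
  "norm (unity_root n k - 1) \<le> 2 * pi * \<bar>of_int k\<bar> / (2 * real n + 1)"
proof -
  define x where "x = 2 * pi * of_int k / (2 * real n + 1)"
  have "(norm (cis x - 1))\<^sup>2 = (cos x - 1)\<^sup>2 + (sin x)\<^sup>2"
    by (simp add: cmod_power2)
  also have "\<dots> = 2 - 2 * cos x"
    using sin_cos_squared_add[of x] by (simp add: power2_eq_square algebra_simps)
  also have "\<dots> = (2 * sin (x/2))\<^sup>2"
    using cos_double_sin[of "x/2"] by (simp add: power2_eq_square)
  also have "\<dots> \<le> x\<^sup>2"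
    using abs_sin_x_le_abs_x[of "x/2"] by (intro abs_le_square_iff[THEN iffD1]) simp
  finally have "norm (cis x - 1) \<le> \<bar>x\<bar>"
    by (metis abs_norm_cancel abs_le_square_iff)
  then show ?thesis by (simp add: x_def unity_root_def abs_mult)
qed

text \<open>From \<open>2 * n + 1 \<le> 2 * m * (r + 1)\<close> the angle is at least
  \<open>pi / m\<close>, and \<open>|k| \<le> n\<close> keeps it at most \<open>pi\<close>, where
  cosine decreases. Thus the roots beyond the cutoff lie on an arc that depends on \<open>m\<close>
  but not on \<open>r\<close>.\<close>

lemma Re_unity_root_le:
  assumes "r \<ge> 1" "m \<ge> 1" "n = r * m" "int r < \<bar>k\<bar>" "\<bar>k\<bar> \<le> int n"
  shows "Re (unity_root n k) \<le> cos (pi / real m)"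
proof -
  define x where "x = 2 * pi * \<bar>of_int k\<bar> / (2 * real n + 1)"
  have "Re (unity_root n k) = cos x"
    by (cases "k \<ge> 0") (simp_all add: unity_root_def x_def)
  also have "\<dots> \<le> cos (pi / real m)"
  proof (rule cos_monotone_0_pi_le)
    have k: "real r + 1 \<le> \<bar>of_int k\<bar>" "\<bar>of_int k\<bar> \<le> real n" using assms by linarith+
    have "2 * real n + 1 \<le> 2 * real m * (real r + 1)"
      using assms by (simp add: algebra_simps)
    also have "\<dots> \<le> 2 * real m * \<bar>of_int k\<bar>"
      using k by (intro mult_left_mono) auto
    finally have "pi * (2 * real n + 1) \<le> pi * (2 * real m * \<bar>of_int k\<bar>)"
      by (intro mult_left_mono) auto
    then have "pi \<le> pi * (2 * real m * \<bar>of_int k\<bar>) / (2 * real n + 1)"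
      by (subst pos_le_divide_eq) linarith+
    then show "pi / real m \<le> x"
      using assms(2) by (subst pos_divide_le_eq) (simp_all add: x_def mult_ac)
    have "pi * (2 * \<bar>of_int k\<bar>) \<le> pi * (2 * real n + 1)"
      using k by (intro mult_left_mono) auto
    then show "x \<le> pi" by (simp add: x_def field_simps)
    show "0 \<le> pi / real m" by simp
  qed
  finally show ?thesis .
qed

text \<open>Cauchy-Schwarz over \<open>l\<close>, then Parseval for each factor. The ratio 4 of the
  cardinalities is a square, so the bound has no root: its factor 2 is
  \<open>sqrt 4\<close>.\<close>

lemma sum_norm_mult_unity_root_le:
  fixes c d :: "int \<Rightarrow> complex"
  assumes "A \<subseteq> {-int n..int n}" "B \<subseteq> {-int n..int n}"
    and c: "\<And>j. j \<in> A \<Longrightarrow> norm (c j) \<le> x" and d: "\<And>j. j \<in> B \<Longrightarrow> norm (d j) \<le> y"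
    and xy: "0 \<le> x" "0 \<le> y" and card: "card A \<le> 4 * card B"
  shows "(\<Sum>l=-int n..int n. norm (\<Sum>j\<in>A. c j * unity_root n (- (j * l))) *
     norm (\<Sum>j\<in>B. d j * unity_root n (- (j * l)))) \<le> (2 * real n + 1) * 2 * real (card B) * x * y"
    (is "(\<Sum>l\<in>_. ?a l * ?b l) \<le> ?R")
proof -
  let ?N = "2 * real n + 1"
  have sa: "(\<Sum>l=-int n..int n. (?a l)\<^sup>2) \<le> ?N * (real (card A) * x\<^sup>2)"
  proof -
    have "(\<Sum>j\<in>A. (norm (c j))\<^sup>2) \<le> (\<Sum>j\<in>A. x\<^sup>2)"
      using c by (intro sum_mono power_mono) auto
    then show ?thesis
      by (simp add: unity_root_parseval[OF assms(1)])
  qed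
  have sb: "(\<Sum>l=-int n..int n. (?b l)\<^sup>2) \<le> ?N * (real (card B) * y\<^sup>2)"
  proof -
    have "(\<Sum>j\<in>B. (norm (d j))\<^sup>2) \<le> (\<Sum>j\<in>B. y\<^sup>2)"
      using d by (intro sum_mono power_mono) auto
    then show ?thesis
      by (simp add: unity_root_parseval[OF assms(2)])
  qed
  have "(\<Sum>l=-int n..int n. ?a l * ?b l)\<^sup>2
      \<le> (\<Sum>l=-int n..int n. (?a l)\<^sup>2) * (\<Sum>l=-int n..int n. (?b l)\<^sup>2)"
    by (rule Cauchy_Schwarz_ineq_sum)
  also have "\<dots> \<le> (?N * (real (card A) * x\<^sup>2)) * (?N * (real (card B) * y\<^sup>2))"
    by (intro mult_mono sa sb sum_nonneg) auto
  also have "\<dots> \<le> (?N * (4 * real (card B) * x\<^sup>2)) * (?N * (real (card B) * y\<^sup>2))"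
    using card by (intro mult_right_mono mult_left_mono) auto
  also have "\<dots> = ?R\<^sup>2"
  proof -
    have "(N * (4 * b * x\<^sup>2)) * (N * (b * y\<^sup>2)) = (N * 2 * b * x * y)\<^sup>2" for N b :: real
      by (simp add: power2_eq_square)
    then show ?thesis .
  qed
  finally have sq: "(\<Sum>l=-int n..int n. ?a l * ?b l)\<^sup>2 \<le> ?R\<^sup>2" .
  have "0 \<le> ?R" by (intro mult_nonneg_nonneg xy) auto
  with sq show ?thesis by (rule power2_le_imp_le)
qed

text \<open>
  Here \<open>g\<close> is the discrete Fourier transform of \<open>(z - 1) p(z)\<close>, where the trapezoid \<open>p\<close> is a
  normalised convolution of two indicator functions, so that its transform is the product \<open>a b\<close>.
  Multiplication by \<open>z - 1\<close> becomes a difference operator on the transform, and Cauchy-Schwarz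
  with Parseval bounds the \<open>\<ell>\<^sup>1\<close>-norm.
\<close>
lemma fourier_cutoff:
  assumes r: "r \<ge> 1" and m: "m \<ge> 4" and n: "n = r * m"
  obtains g h :: "int \<Rightarrow> complex" where
    "\<And>k. \<bar>k\<bar> \<le> int r \<Longrightarrow> h k = 0"
    "\<And>k. norm (h k) \<le> 2"
    "\<And>l. \<bar>l\<bar> \<le> int n \<Longrightarrow> of_bool (l = 1) - of_bool (l = 0) = g l +
       (\<Sum>k=-int n..int n. h k * unity_root n (- (k * l))) / (2 * of_nat n + 1)"
    "(\<Sum>l=-int n..int n. norm (g l)) \<le> 24 / real m"
proof -
  let ?e = "unity_root n" and ?K = "{-int n..int n}" and ?N = "2 * real n + 1"
  \<comment> \<open>\<open>A\<close> is twice as wide as \<open>B\<close>, so \<open>k - i\<close>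
    stays in \<open>A\<close> for all \<open>i\<close> in \<open>B\<close> when
    \<open>|k| \<le> r\<close>, and \<open>p\<close> is 1 there. Sums \<open>i + j\<close> have
    modulus at most \<open>3 * r\<close>; as \<open>4 * r \<le> n\<close>, they never wrap around
    modulo \<open>2 * n + 1\<close>.\<close>
  define A where "A = {-2 * int r..2 * int r}"
  define B where "B = {-int r..int r}"
  have "4 * r \<le> n" using mult_le_mono1[OF m, of r] by (simp add: n mult.commute)
  then have AK: "A \<subseteq> ?K" and BK: "B \<subseteq> ?K" and ABK: "\<And>i j. i \<in> A \<Longrightarrow> j \<in> B \<Longrightarrow> i + j \<in> ?K"
    using r by (auto simp: A_def B_def)
  have cA: "card A = 4 * r + 1" and cB: "card B = 2 * r + 1"
    by (auto simp: A_def B_def)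
  define p where "p = (\<lambda>k. real (card {i \<in> B. k - i \<in> A}) / real (card B))"
  have finB: "finite B" by (simp add: B_def)
  have p01: "0 \<le> p k" "p k \<le> 1" for k
    using card_mono[OF finB, of "{i \<in> B. k - i \<in> A}"] by (auto simp: p_def cB field_simps)
  have p1: "p k = 1" if "\<bar>k\<bar> \<le> int r" for k
  proof -
    have "{i \<in> B. k - i \<in> A} = B" using that by (auto simp: A_def B_def)
    then show ?thesis by (simp add: p_def cB)
  qed
  define h where "h = (\<lambda>k. (?e k - 1) * of_real (1 - p k))"
  define a where "a = (\<lambda>l. \<Sum>j\<in>A. ?e (- (j * l)))"
  define b where "b = (\<lambda>l. \<Sum>j\<in>B. ?e (- (j * l)))"
  \<comment> \<open>The transform of \<open>(?e k - 1) * p k\<close>: the factor \<open>?e k\<close>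
    shifts \<open>l\<close> to \<open>l - 1\<close>, while \<open>?N\<close> and
    \<open>card B\<close> normalise the transform and \<open>p\<close>.\<close>
  define g where "g = (\<lambda>l. (a (l - 1) * b (l - 1) - a l * b l) / of_real (?N * real (card B)))"
  have sum_p: "(\<Sum>k\<in>?K. of_real (p k) * ?e (- (k * l))) = a l * b l / of_nat (card B)" for l
  proof -
    have "of_real (p k) * ?e (- (k * l)) = (\<Sum>j\<in>B. if k - j \<in> A then ?e (- (k * l)) else 0) / of_nat (card B)" for k
      using finB by (simp add: p_def sum.If_cases Int_def)
    then have "(\<Sum>k\<in>?K. of_real (p k) * ?e (- (k * l)))
      = (\<Sum>k\<in>?K. \<Sum>j\<in>B. if k - j \<in> A then ?e (- (k * l)) else 0) / of_nat (card B)"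
      by (simp add: sum_divide_distrib)
    also have "(\<Sum>k\<in>?K. \<Sum>j\<in>B. if k - j \<in> A then ?e (- (k * l)) else 0)
      = (\<Sum>j\<in>B. \<Sum>k\<in>?K. if k - j \<in> A then ?e (- (k * l)) else 0)"
      by (rule sum.swap)
    also have "\<dots> = (\<Sum>j\<in>B. \<Sum>i\<in>A. ?e (- ((i + j) * l)))"
    proof (rule sum.cong[OF refl])
      fix j assume j: "j \<in> B"
      have "(\<Sum>k\<in>?K. if k - j \<in> A then ?e (- (k * l)) else 0)
        = (\<Sum>k\<in>{k \<in> ?K. k - j \<in> A}. ?e (- (k * l)))"
        by (intro sum.mono_neutral_cong_right) auto
      also have "\<dots> = (\<Sum>i\<in>A. ?e (- ((i + j) * l)))"
        using ABK[OF _ j] by (intro sum.reindex_bij_witness[of _ "\<lambda>i. i + j" "\<lambda>k. k - j"]) auto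
      finally show "(\<Sum>k\<in>?K. if k - j \<in> A then ?e (- (k * l)) else 0)
        = (\<Sum>i\<in>A. ?e (- ((i + j) * l)))" .
    qed
    also have "\<dots> = a l * b l"
      unfolding a_def b_def sum_product
      by (subst sum.swap) (intro sum.cong refl, simp add: algebra_simps flip: unity_root_add)
    finally show ?thesis .
  qed
  have sum_e: "(\<Sum>k\<in>?K. ?e (- (k * l))) = (2 * of_nat n + 1) * of_bool (l = 0)" if "\<bar>l\<bar> \<le> 2 * int n" for l
    using sum_unity_root[of "- l" n] that by (simp add: mult.commute)
  show thesis
  proof
    show "h k = 0" if "\<bar>k\<bar> \<le> int r" for k
      using p1[OF that] by (simp add: h_def)
    show "norm (h k) \<le> 2" for k
    proof -
      have "norm (h k) \<le> 2 * 1"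
        unfolding h_def norm_mult norm_of_real using p01[of k] norm_triangle_ineq4[of "?e k" 1]
        by (intro mult_mono) auto
      then show ?thesis by simp
    qed
    show "of_bool (l = 1) - of_bool (l = 0) = g l +
       (\<Sum>k\<in>?K. h k * ?e (- (k * l))) / (2 * of_nat n + 1)" if l: "\<bar>l\<bar> \<le> int n" for l
    proof -
      have "of_nat (2 * n + 1) \<noteq> (0::complex)"
        by (simp only: of_nat_eq_0_iff)
      then have N: "2 * of_nat n + 1 \<noteq> (0::complex)" by (simp add: add.commute)
      have n1: "1 \<le> n" using \<open>4 * r \<le> n\<close> r by linarith
      have shift: "?e k * ?e (- (k * l)) = ?e (- (k * (l - 1)))" for k
        by (simp add: algebra_simps flip: unity_root_add)
      have hk: "h k * ?e (- (k * l)) = ?e (- (k * (l - 1))) - ?e (- (k * l))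
        - (of_real (p k) * ?e (- (k * (l - 1))) - of_real (p k) * ?e (- (k * l)))" for k
        unfolding h_def shift[symmetric] by (simp add: algebra_simps)
      have "(\<Sum>k\<in>?K. h k * ?e (- (k * l)))
        = (2 * of_nat n + 1) * of_bool (l - 1 = 0) - (2 * of_nat n + 1) * of_bool (l = 0)
          - (a (l - 1) * b (l - 1) / of_nat (card B) - a l * b l / of_nat (card B))"
        unfolding hk sum_subtractf sum_p
        using sum_e[of "l - 1"] sum_e[of l] l n1 by simp
      then show ?thesis using N by (simp add: g_def diff_divide_distrib)
    qed
    \<comment> \<open>\<open>x\<close> bounds the distance from 1 to the roots with index in
      \<open>B\<close>; indices in \<open>A\<close> are up to twice as large and give
      \<open>2 * x\<close>.\<close>
    define x where "x = 2 * pi * real r / ?N"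
    have x0: "0 \<le> x" by (simp add: x_def)
    have ex: "norm (?e j - 1) \<le> 2 * x" if "j \<in> A" for j
    proof -
      have "2 * pi * \<bar>of_int j\<bar> \<le> 2 * pi * (2 * real r)"
        using that by (intro mult_left_mono) (auto simp: A_def abs_if)
      then have "2 * pi * \<bar>of_int j\<bar> / ?N \<le> 2 * pi * (2 * real r) / ?N"
        by (intro divide_right_mono) auto
      then show ?thesis using norm_unity_root_minus_1_le[of n j] by (simp add: x_def)
    qed
    have ex': "norm (?e j - 1) \<le> x" if "j \<in> B" for j
    proof -
      have "2 * pi * \<bar>of_int j\<bar> \<le> 2 * pi * real r"
        using that by (intro mult_left_mono) (auto simp: B_def abs_if)
      then have "2 * pi * \<bar>of_int j\<bar> / ?N \<le> 2 * pi * real r / ?N"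
        by (intro divide_right_mono) auto
      then show ?thesis using norm_unity_root_minus_1_le[of n j] by (simp add: x_def)
    qed
    have shift: "?e (- (k * (l - 1))) = ?e k * ?e (- (k * l))" for k l
      by (simp add: algebra_simps flip: unity_root_add)
    let ?da = "\<lambda>l. norm (\<Sum>j\<in>A. (?e j - 1) * ?e (- (j * l)))"
    let ?db = "\<lambda>l. norm (\<Sum>j\<in>B. (?e j - 1) * ?e (- (j * l)))"
    let ?a = "\<lambda>l. norm (\<Sum>j\<in>A. 1 * ?e (- (j * l)))"
    let ?b = "\<lambda>l. norm (\<Sum>j\<in>B. ?e j * ?e (- (j * l)))"
    have s1: "(\<Sum>l\<in>?K. ?da l * ?b l) \<le> ?N * 2 * real (card B) * (2 * x) * 1"
      by (rule sum_norm_mult_unity_root_le) (use AK BK ex x0 cA cB in auto)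
    have s2: "(\<Sum>l\<in>?K. ?a l * ?db l) \<le> ?N * 2 * real (card B) * 1 * x"
      by (rule sum_norm_mult_unity_root_le) (use AK BK ex' x0 cA cB in auto)
    \<comment> \<open>Discrete product rule: in each summand only one factor is differenced, and its
      coefficients become the small numbers \<open>?e j - 1\<close>.\<close>
    have gl: "norm (g l) \<le> (?da l * ?b l + ?a l * ?db l) / (?N * real (card B))" for l
    proof -
      have "a (l - 1) * b (l - 1) - a l * b l
        = (a (l - 1) - a l) * b (l - 1) + a l * (b (l - 1) - b l)"
        by (simp add: algebra_simps)
      also have "\<dots> = (\<Sum>j\<in>A. (?e j - 1) * ?e (- (j * l))) * (\<Sum>j\<in>B. ?e j * ?e (- (j * l)))
         + (\<Sum>j\<in>A. 1 * ?e (- (j * l))) * (\<Sum>j\<in>B. (?e j - 1) * ?e (- (j * l)))"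
        by (simp add: a_def b_def shift left_diff_distrib sum_subtractf)
      finally have "norm (a (l - 1) * b (l - 1) - a l * b l) \<le> ?da l * ?b l + ?a l * ?db l"
        by (simp only: norm_mult[symmetric] norm_triangle_ineq)
      then have "norm (a (l - 1) * b (l - 1) - a l * b l) / (?N * real (card B))
          \<le> (?da l * ?b l + ?a l * ?db l) / (?N * real (card B))"
        by (intro divide_right_mono) auto
      then show ?thesis
        unfolding g_def norm_divide norm_of_real by (simp add: abs_mult)
    qed
    have "(\<Sum>l\<in>?K. norm (g l)) \<le> (\<Sum>l\<in>?K. (?da l * ?b l + ?a l * ?db l) / (?N * real (card B)))"
      by (intro sum_mono gl)
    also have "\<dots> = ((\<Sum>l\<in>?K. ?da l * ?b l) + (\<Sum>l\<in>?K. ?a l * ?db l)) / (?N * real (card B))"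
      by (simp only: sum.distrib flip: sum_divide_distrib)
    also have "\<dots> \<le> (?N * 2 * real (card B) * (2 * x) * 1 + ?N * 2 * real (card B) * 1 * x) / (?N * real (card B))"
      by (intro divide_right_mono add_mono s1 s2) auto
    also have "\<dots> = (?N * real (card B)) * (6 * x) / (?N * real (card B))"
      by (simp add: algebra_simps)
    also have "\<dots> = 6 * x"
      by (rule nonzero_mult_div_cancel_left) (simp add: cB add_nonneg_eq_0_iff)
    \<comment> \<open>Here \<open>6 * x = 12 * pi * r / (2 * n + 1)\<close>; now use
      \<open>2 * n + 1 \<ge> 2 * r * m\<close> and \<open>pi < 4\<close>.\<close>
    also have "\<dots> \<le> 24 / real m"
    proof -
      have "pi * (real r * real m) \<le> 4 * (real r * real m)"
        using pi_less_4 by (intro mult_right_mono) auto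
      then have "12 * pi * (real r * real m) \<le> 24 * ?N"
        by (simp add: n)
      then have "12 * pi * real r * real m \<le> 24 * ?N" by (simp add: mult_ac)
      then show ?thesis using m by (simp add: x_def field_simps)
    qed
    finally show "(\<Sum>l\<in>?K. norm (g l)) \<le> 24 / real m" .
  qed
qed

section \<open>Fejer averages and the seminorm of consecutive differences\<close>

interpretation scaleC_left: additive "\<lambda>a. scaleC a (x :: 'a :: complex_vector)" for x
  by standard (rule scaleC_add_left)

interpretation scaleC_right: additive "scaleC a :: 'a \<Rightarrow> 'a :: complex_vector" for a
  by standard (rule scaleC_add_right)

text \<open>Up to one extra \<open>u n\<close>, \<open>n\<close> times the difference is a Fejer
  average with the Fourier coefficients of \<open>z - 1\<close>, which \<open>fourier_cutoff\<close>
  splits. The \<open>g\<close> part costs at most its l1-norm times \<open>C\<close> in each of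
  \<open>n\<close> rows. The \<open>h\<close> part is a mean over \<open>2 * n + 1\<close>
  frequencies of terms of seminorm at most \<open>2 * K\<close>.\<close>

lemma seminorm_power_difference_le:
  fixes q :: "'b::complex_vector \<Rightarrow> real" and u :: "nat \<Rightarrow> 'b"
  assumes q_nonneg: "\<And>x. 0 \<le> q x"
    and q_add: "\<And>x y. q (x + y) \<le> q x + q y"
    and q_scale: "\<And>c x. q (scaleC c x) \<le> norm c * q x"
    and q_u: "\<And>i. q (u i) \<le> C"
    and far: "\<And>n w. norm w = 1 \<Longrightarrow> Re w \<le> cos (pi / real m) \<Longrightarrow>
       q (\<Sum>i<n. \<Sum>j<n. scaleC (inverse w ^ (i + j)) (u (i + j))) \<le> K"
    and r: "r \<ge> 1" and m: "m \<ge> 4" and n: "n = r * m"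
  shows "q (u n - u (n - 1)) \<le> 24 * C / real m + (C + 2 * K) / real n"
proof -
  obtain g h :: "int \<Rightarrow> complex" where h0: "\<And>k. \<bar>k\<bar> \<le> int r \<Longrightarrow> h k = 0"
    and h2: "\<And>k. norm (h k) \<le> 2"
    and gh: "\<And>l. \<bar>l\<bar> \<le> int n \<Longrightarrow> of_bool (l = 1) - of_bool (l = 0) = g l +
       (\<Sum>k=-int n..int n. h k * unity_root n (- (k * l))) / (2 * of_nat n + 1)"
    and g1: "(\<Sum>l=-int n..int n. norm (g l)) \<le> 24 / real m"
    by (rule fourier_cutoff[OF r m n], rule that)
  let ?K = "{-int n..int n}" and ?N = "2 * of_nat n + 1 :: complex"
  have n1: "1 \<le> n" using mult_le_mono[OF r, of 1 m] m n by linarith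
  have q0: "q 0 = 0"
    using q_scale[of 0 0] q_nonneg[of 0] by (simp add: scaleC_left.zero)
  have q_sum: "q (sum f A) \<le> (\<Sum>x\<in>A. q (f x))" if "finite A" for f :: "'c \<Rightarrow> 'b" and A
    using that
  proof (induction rule: finite_induct)
    case empty then show ?case by (simp add: q0)
  next
    case (insert x F)
    then show ?case using q_add[of "f x" "sum f F"] by simp
  qed
  have C0: "0 \<le> C" using q_u q_nonneg order_trans by blast
  have K0: "0 \<le> K"
    using far[of "-1" 0] q_nonneg by (simp add: q0)
  \<comment> \<open>Fejer averages: the weight of \<open>u (n - 1 + l)\<close> is \<open>(n - \<bar>l\<bar>) f(l)\<close>, and a single frequency
    turns the double sum into a product of two geometric sums.\<close>
  define W where "W = (\<lambda>f. \<Sum>i<n. \<Sum>j<n. scaleC (f (int i + int j + 1 - int n)) (u (i + j)))"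
  define E where "E = (\<lambda>l::int. of_bool (l = 1) - of_bool (l = 0) :: complex)"
  define H where "H = (\<lambda>l. (\<Sum>k\<in>?K. h k * unity_root n (- (k * l))) / ?N)"
  have W_split: "W E = W g + W H"
    unfolding W_def sum.distrib[symmetric] scaleC_add_left[symmetric]
  proof (intro sum.cong refl arg_cong2[where f = scaleC])
    fix i j assume "i \<in> {..<n}" "j \<in> {..<n}"
    then have "\<bar>int i + int j + 1 - int n\<bar> \<le> int n" by auto
    from gh[OF this]
    show "E (int i + int j + 1 - int n) = g (int i + int j + 1 - int n) + H (int i + int j + 1 - int n)"
      unfolding E_def H_def .
  qed
  \<comment> \<open>The value at 1 selects the \<open>n - 1\<close> pairs with
    \<open>i + j = n\<close>, the value at 0 the \<open>n\<close> pairs with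
    \<open>i + j = n - 1\<close>.\<close>
  have W_E: "W E = scaleC (of_nat (n - 1)) (u n) - scaleC (of_nat n) (u (n - 1))"
  proof -
    have "(\<Sum>j<n. scaleC (E (int i + int j + 1 - int n)) (u (i + j)))
       = scaleC (of_bool (i \<noteq> 0)) (u n) - u (n - 1)" if i: "i < n" for i
    proof -
      have "scaleC (E (int i + int j + 1 - int n)) (u (i + j))
         = (if j = n - i then u n else 0) - (if j = n - 1 - i then u (n - 1) else 0)" if "j < n" for j
        using that i by (auto simp: E_def scaleC_left.diff scaleC_one scaleC_left.zero)
      then have "(\<Sum>j<n. scaleC (E (int i + int j + 1 - int n)) (u (i + j)))
         = (\<Sum>j<n. (if j = n - i then u n else 0) - (if j = n - 1 - i then u (n - 1) else 0))"
        by (intro sum.cong) auto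
      also have "\<dots> = scaleC (of_bool (i \<noteq> 0)) (u n) - u (n - 1)"
        using i by (auto simp: sum_subtractf scaleC_one scaleC_left.zero)
      finally show ?thesis .
    qed
    then have "W E = (\<Sum>i<n. scaleC (of_bool (i \<noteq> 0)) (u n) - u (n - 1))"
      unfolding W_def by (intro sum.cong) auto
    also have "\<dots> = (\<Sum>i<n. scaleC (of_bool (i \<noteq> 0)) (u n)) - (\<Sum>i<n. scaleC 1 (u (n - 1)))"
      by (simp add: sum_subtractf scaleC_one)
    also have "\<dots> = scaleC (\<Sum>i<n. of_bool (i \<noteq> 0)) (u n) - scaleC (\<Sum>i<n. 1) (u (n - 1))"
      by (simp only: scaleC_left.sum)
    also have "(\<Sum>i<n. of_bool (i \<noteq> 0)) = (of_nat (n - 1) :: complex)"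
    proof -
      have "{..<n} \<inter> {i. i \<noteq> 0} = {1..<n}" by auto
      then show ?thesis by (simp add: sum_of_bool_eq)
    qed
    finally show ?thesis by simp
  qed
  have "scaleC (of_nat n) (u n - u (n - 1)) = u n + W E"
  proof -
    have "scaleC (of_nat n) (u n) = scaleC (1 + of_nat (n - 1)) (u n)"
      using n1 by (simp add: of_nat_diff)
    then show ?thesis
      by (simp add: W_E scaleC_right.diff scaleC_add_left scaleC_one)
  qed
  then have "u n - u (n - 1) = scaleC (inverse (of_nat n)) (u n + W g + W H)"
    using n1 by (metis W_split add.assoc scaleC_scaleC left_inverse scaleC_one of_nat_eq_0_iff not_one_le_zero)
  then have "q (u n - u (n - 1)) \<le> norm (inverse (of_nat n :: complex)) * q (u n + W g + W H)"
    by (simp only: q_scale)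
  also have "\<dots> \<le> norm (inverse (of_nat n :: complex)) * (C + real n * (24 / real m * C) + 2 * K)"
  proof (rule mult_left_mono)
    have Wg: "q (W g) \<le> real n * (24 / real m * C)"
    proof -
      \<comment> \<open>For fixed \<open>i\<close> the arguments of \<open>g\<close> are distinct
        and lie in \<open>-n..n\<close>, so the l1-norm of \<open>g\<close> bounds the whole
        row.\<close>
      have row: "q (\<Sum>j<n. scaleC (g (int i + int j + 1 - int n)) (u (i + j))) \<le> 24 / real m * C"
        if i: "i < n" for i
      proof -
        have "q (\<Sum>j<n. scaleC (g (int i + int j + 1 - int n)) (u (i + j)))
          \<le> (\<Sum>j<n. q (scaleC (g (int i + int j + 1 - int n)) (u (i + j))))"
          by (rule q_sum) simp
        also have "\<dots> \<le> (\<Sum>j<n. norm (g (int i + int j + 1 - int n)) * C)"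
          by (intro sum_mono order_trans[OF q_scale] mult_left_mono q_u) auto
        also have "\<dots> = (\<Sum>l\<in>(\<lambda>j. int i + int j + 1 - int n) ` {..<n}. norm (g l)) * C"
          by (subst sum.reindex) (auto simp: inj_on_def sum_distrib_right)
        also have "\<dots> \<le> (\<Sum>l\<in>?K. norm (g l)) * C"
          using i C0 by (intro mult_right_mono sum_mono2) auto
        also have "\<dots> \<le> 24 / real m * C"
          using g1 C0 by (rule mult_right_mono)
        finally show ?thesis .
      qed
      have "q (W g) \<le> (\<Sum>i<n. q (\<Sum>j<n. scaleC (g (int i + int j + 1 - int n)) (u (i + j))))"
        unfolding W_def by (rule q_sum) simp
      also have "\<dots> \<le> (\<Sum>i<n. 24 / real m * C)"
        by (intro sum_mono row) auto
      finally show ?thesis by simp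
    qed
    have WH: "q (W H) \<le> 2 * K"
    proof -
      \<comment> \<open>Each frequency contributes a phase of modulus 1 times a power with exponent
        \<open>i + j\<close>. The phase leaves the double sum, and what remains is the sum that
        \<open>far\<close> bounds for \<open>|k| > r\<close>.\<close>
      define V where "V = (\<lambda>k. \<Sum>i<n. \<Sum>j<n.
        scaleC (inverse (unity_root n k) ^ (i + j)) (u (i + j)))"
      have term_eq: "scaleC (H (int i + int j + 1 - int n)) (u (i + j))
        = (\<Sum>k\<in>?K. scaleC (h k * unity_root n (k * (int n - 1)) / ?N)
             (scaleC (inverse (unity_root n k) ^ (i + j)) (u (i + j))))" for i j
      proof -
        have "unity_root n (- (k * (int i + int j + 1 - int n)))
          = unity_root n (k * (int n - 1)) * inverse (unity_root n k) ^ (i + j)" for k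
        proof -
          have "- (k * (int i + int j + 1 - int n)) = k * (int n - 1) + (- k) * int (i + j)"
            by (simp add: algebra_simps)
          then show ?thesis
            by (simp only: unity_root_add unity_root_mult_nat unity_root_inverse)
        qed
        then have "H (int i + int j + 1 - int n)
          = (\<Sum>k\<in>?K. h k * unity_root n (k * (int n - 1)) / ?N * inverse (unity_root n k) ^ (i + j))"
          by (simp add: H_def sum_divide_distrib mult.assoc)
        then show ?thesis
          by (simp only: scaleC_left.sum scaleC_scaleC)
      qed
      have "W H = (\<Sum>i<n. \<Sum>k\<in>?K. \<Sum>j<n. scaleC (h k * unity_root n (k * (int n - 1)) / ?N)
             (scaleC (inverse (unity_root n k) ^ (i + j)) (u (i + j))))"
        unfolding W_def term_eq by (intro sum.cong refl sum.swap)
      also have "\<dots> = (\<Sum>k\<in>?K. \<Sum>i<n. \<Sum>j<n. scaleC (h k * unity_root n (k * (int n - 1)) / ?N)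
             (scaleC (inverse (unity_root n k) ^ (i + j)) (u (i + j))))"
        by (rule sum.swap)
      also have "\<dots> = (\<Sum>k\<in>?K. scaleC (h k * unity_root n (k * (int n - 1)) / ?N) (V k))"
        by (simp only: V_def scaleC_right.sum)
      finally have "q (W H) \<le> (\<Sum>k\<in>?K. q (scaleC (h k * unity_root n (k * (int n - 1)) / ?N) (V k)))"
        by (simp add: q_sum)
      also have "\<dots> \<le> (\<Sum>k\<in>?K. 2 * K / (2 * real n + 1))"
      proof (rule sum_mono)
        fix k assume k: "k \<in> ?K"
        have N: "norm ?N = 2 * real n + 1"
          using norm_of_nat[of "2 * n + 1", where 'a = complex] by (simp add: add.commute)
        have "q (scaleC (h k * unity_root n (k * (int n - 1)) / ?N) (V k))
           \<le> norm (h k) / (2 * real n + 1) * q (V k)"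
          using q_scale[of "h k * unity_root n (k * (int n - 1)) / ?N" "V k"]
          by (simp only: norm_divide norm_mult norm_unity_root N mult_1_right)
        also have "\<dots> \<le> 2 / (2 * real n + 1) * K"
        proof (cases "\<bar>k\<bar> \<le> int r")
          case True
          then show ?thesis by (simp add: h0 K0)
        next
          case False
          have "Re (unity_root n k) \<le> cos (pi / real m)"
            by (rule Re_unity_root_le[of r m]) (use r m n k False in auto)
          then have "q (V k) \<le> K"
            unfolding V_def by (intro far) auto
          then show ?thesis
            using h2[of k] q_nonneg by (intro mult_mono divide_right_mono) auto
        qed
        finally show "q (scaleC (h k * unity_root n (k * (int n - 1)) / ?N) (V k)) \<le> 2 * K / (2 * real n + 1)"
          by simp
      qed
      also have "\<dots> = (2 * real n + 1) * (2 * K / (2 * real n + 1))"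
        by simp
      also have "\<dots> = 2 * K"
        by (simp add: add_nonneg_eq_0_iff)
      finally show ?thesis .
    qed
    show "q (u n + W g + W H) \<le> C + real n * (24 / real m * C) + 2 * K"
      using q_add[of "u n + W g" "W H"] q_add[of "u n" "W g"] q_u[of n] Wg WH by linarith
  qed simp
  also have "\<dots> = 24 * C / real m + (C + 2 * K) / real n"
  proof -
    have "inverse x * (C + x * (24 / y * C) + 2 * K) = 24 * C / y + (C + 2 * K) / x"
      if "x \<noteq> 0" "y \<noteq> 0" for x y :: real
      using that by (simp add: field_simps)
    from this[of "real n" "real m"] show ?thesis
      using n1 m by (simp add: norm_inverse)
  qed
  finally show ?thesis .
qed

section \<open>The asymptotic seminorm\<close>

text \<open>The limit superior of the norms, for bounded sequences.\<close>
definition asymp_norm :: "(nat \<Rightarrow> 'b::real_normed_vector) \<Rightarrow> real" where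
  "asymp_norm s = Inf {c. \<forall>\<^sub>F n in sequentially. norm (s n) \<le> c}"

lemma eventually_norm_le_imp_nonneg:
  fixes s :: "nat \<Rightarrow> 'b::real_normed_vector"
  assumes "\<forall>\<^sub>F n in sequentially. norm (s n) \<le> c"
  shows "0 \<le> c"
proof -
  from assms obtain n where "norm (s n) \<le> c"
    by (auto simp: eventually_sequentially)
  then show ?thesis using norm_ge_zero order_trans by blast
qed

lemma asymp_norm_le:
  assumes "\<forall>\<^sub>F n in sequentially. norm (s n) \<le> c"
  shows "asymp_norm s \<le> c"
  unfolding asymp_norm_def
  by (rule cInf_lower) (use assms in \<open>auto intro!: bdd_belowI[of _ 0] eventually_norm_le_imp_nonneg\<close>)

lemma eventual_bounds_nonempty:
  assumes "Bseq s"
  shows "{c. \<forall>\<^sub>F n in sequentially. norm (s n) \<le> c} \<noteq> {}"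
proof -
  from assms obtain K where "\<And>n. norm (s n) \<le> K"
    by (meson BseqE)
  then have "\<forall>\<^sub>F n in sequentially. norm (s n) \<le> K"
    by (simp add: always_eventually)
  then show ?thesis by blast
qed

lemma asymp_norm_nonneg:
  assumes "Bseq s"
  shows "0 \<le> asymp_norm s"
  unfolding asymp_norm_def
  by (rule cInf_greatest[OF eventual_bounds_nonempty[OF assms]])
    (blast intro: eventually_norm_le_imp_nonneg)

lemma eventually_norm_le_if_asymp_norm_less:
  assumes "Bseq s" and "asymp_norm s < c"
  shows "\<forall>\<^sub>F n in sequentially. norm (s n) \<le> c"
proof -
  from cInf_lessD[OF eventual_bounds_nonempty[OF assms(1)] assms(2)[unfolded asymp_norm_def]]
  obtain d where "\<forall>\<^sub>F n in sequentially. norm (s n) \<le> d" and "d < c" by auto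
  from this(1) show ?thesis by eventually_elim (use \<open>d < c\<close> in simp)
qed

lemma asymp_norm_add:
  assumes s: "Bseq s" and t: "Bseq t"
  shows "asymp_norm (\<lambda>n. s n + t n) \<le> asymp_norm s + asymp_norm t"
proof (rule field_le_epsilon)
  fix e :: real assume e: "0 < e"
  have "\<forall>\<^sub>F n in sequentially. norm (s n) \<le> asymp_norm s + e / 2"
    "\<forall>\<^sub>F n in sequentially. norm (t n) \<le> asymp_norm t + e / 2"
    using e s t by (auto intro: eventually_norm_le_if_asymp_norm_less)
  then have "\<forall>\<^sub>F n in sequentially. norm (s n + t n) \<le> asymp_norm s + asymp_norm t + e"
    by eventually_elim (rule norm_triangle_le, simp)
  then show "asymp_norm (\<lambda>n. s n + t n) \<le> asymp_norm s + asymp_norm t + e"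
    by (rule asymp_norm_le)
qed

lemma asymp_norm_mono_scaled:
  assumes s: "Bseq s" and c: "0 \<le> c" and le: "\<And>n. norm (t n) \<le> c * norm (s n)"
  shows "asymp_norm t \<le> c * asymp_norm s"
proof (rule field_le_epsilon)
  fix e :: real assume e: "0 < e"
  \<comment> \<open>Dividing by \<open>c + 1\<close> instead of \<open>c\<close> covers the case
    \<open>c = 0\<close>.\<close>
  have "\<forall>\<^sub>F n in sequentially. norm (s n) \<le> asymp_norm s + e / (c + 1)"
    using e s c by (auto intro: eventually_norm_le_if_asymp_norm_less)
  then have "\<forall>\<^sub>F n in sequentially. norm (t n) \<le> c * asymp_norm s + e"
  proof eventually_elim
    case (elim n)
    have "norm (t n) \<le> c * (asymp_norm s + e / (c + 1))"
      using le[of n] mult_left_mono[OF elim c] by linarith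
    also have "\<dots> \<le> c * asymp_norm s + e"
      using e c by (simp add: field_simps)
    finally show ?case .
  qed
  then show "asymp_norm t \<le> c * asymp_norm s + e"
    by (rule asymp_norm_le)
qed

text \<open>Eventual bounds ignore an index shift. This is the source of the invariance of the
  seminorm \<open>q\<close> under right multiplication by \<open>T\<close>.\<close>

lemma asymp_norm_Suc: "asymp_norm (\<lambda>n. s (Suc n)) = asymp_norm s"
  unfolding asymp_norm_def
  by (subst eventually_sequentially_Suc[of "\<lambda>n. norm (s n) \<le> _"]) simp

lemma asymp_norm_eq_0:
  assumes "s \<longlonglongrightarrow> 0"
  shows "asymp_norm s = 0"
proof (rule antisym)
  show "asymp_norm s \<le> 0"
  proof (rule field_le_epsilon)
    fix e :: real assume "0 < e"
    with assms have "\<forall>\<^sub>F n in sequentially. norm (s n) < e"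
      by (simp add: tendsto_iff)
    then show "asymp_norm s \<le> 0 + e"
      by (intro asymp_norm_le) (auto elim: eventually_mono)
  qed
  show "0 \<le> asymp_norm s"
    using assms by (intro asymp_norm_nonneg) (blast intro: convergentI convergent_imp_Bseq)
qed

lemma tendsto_0_if_asymp_norm_eq_0:
  assumes "Bseq s" and "asymp_norm s = 0"
  shows "s \<longlonglongrightarrow> 0"
proof (rule tendstoI)
  fix e :: real assume "0 < e"
  then have "\<forall>\<^sub>F n in sequentially. norm (s n) \<le> e / 2"
    using assms by (intro eventually_norm_le_if_asymp_norm_less) auto
  then show "\<forall>\<^sub>F n in sequentially. dist (s n) 0 < e"
    by eventually_elim (use \<open>0 < e\<close> in simp)
qed

section \<open>Complex multiples and powers of operators\<close>

lemma scaleC_scaleR_commute: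
  fixes x :: "'a::complex_vector"
  shows "scaleC c (r *\<^sub>R x) = r *\<^sub>R scaleC c x"
  by (simp add: scaleR_scaleC scaleC_scaleC mult.commute)

lemma bounded_linear_scaleC: "bounded_linear (scaleC c :: 'a::complex_normed_vector \<Rightarrow> 'a)"
  by (rule bounded_linear_intro[where K = "norm c"])
    (simp_all add: scaleC_add_right scaleC_scaleR_commute norm_scaleC mult.commute)

text \<open>This makes \<open>seminorm_power_difference_le\<close> applicable to operator powers;
  scalars act on the values.\<close>

instantiation blinfun :: (real_normed_vector, complex_normed_vector) complex_normed_vector
begin

lift_definition scaleC_blinfun :: "complex \<Rightarrow> 'a \<Rightarrow>\<^sub>L 'b \<Rightarrow> 'a \<Rightarrow>\<^sub>L 'b" is
  "\<lambda>c f x. scaleC c (f x)"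
  by (rule bounded_linear_compose[OF bounded_linear_scaleC])

instance
proof
  fix c d :: complex and f g :: "'a \<Rightarrow>\<^sub>L 'b" and r :: real
  show "scaleC c (f + g) = scaleC c f + scaleC c g"
    by transfer (simp add: scaleC_add_right)
  show "scaleC (c + d) f = scaleC c f + scaleC d f"
    by transfer (simp add: scaleC_add_left)
  show assoc: "scaleC c (scaleC d f) = scaleC (c * d) f" for c d and f :: "'a \<Rightarrow>\<^sub>L 'b"
    by transfer (simp add: scaleC_scaleC)
  show one: "scaleC 1 f = f" for f :: "'a \<Rightarrow>\<^sub>L 'b"
    by transfer (simp add: scaleC_one)
  show "r *\<^sub>R f = scaleC (complex_of_real r) f"
    by transfer (simp add: scaleR_scaleC)
  have le: "norm (scaleC c f) \<le> norm c * norm f" for c and f :: "'a \<Rightarrow>\<^sub>L 'b"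
  proof (rule norm_blinfun_bound)
    fix x
    have "norm (scaleC c (blinfun_apply f x)) \<le> norm c * (norm f * norm x)"
      unfolding norm_scaleC by (intro mult_left_mono norm_blinfun) auto
    then show "norm (blinfun_apply (scaleC c f) x) \<le> norm c * norm f * norm x"
      by (simp add: scaleC_blinfun.rep_eq mult.assoc)
  qed simp
  \<comment> \<open>The reverse inequality is \<open>le\<close> for the inverse scalar, applied to
    \<open>scaleC c f\<close>.\<close>
  show "norm (scaleC c f) = norm c * norm f"
  proof (cases "c = 0")
    case True
    then show ?thesis using le[of 0 f] by simp
  next
    case False
    have "norm f = norm (scaleC (inverse c) (scaleC c f))"
      using False by (simp add: assoc one)
    also have "\<dots> \<le> norm (inverse c) * norm (scaleC c f)"
      by (rule le)
    finally have "norm f \<le> norm (scaleC c f) / norm c"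
      by (simp add: norm_inverse divide_inverse mult.commute)
    then have "norm c * norm f \<le> norm (scaleC c f)"
      using False by (simp add: pos_le_divide_eq mult.commute)
    with le[of c f] show ?thesis by simp
  qed
qed

end

lemma scaleC_compose_left: "scaleC c A o\<^sub>L B = scaleC c (A o\<^sub>L B)"
  by (rule blinfun_eqI) (simp add: scaleC_blinfun.rep_eq)

interpretation blinfun_compose: bounded_bilinear "(o\<^sub>L)"
  by (rule bounded_bilinear_blinfun_compose)

lemma blinfun_compose_assoc: "(A o\<^sub>L B) o\<^sub>L C = A o\<^sub>L (B o\<^sub>L C)"
  by (rule blinfun_eqI) simp

lemma blinfun_compose_id [simp]: "A o\<^sub>L id_blinfun = A" "id_blinfun o\<^sub>L A = A"
  by (simp_all add: blinfun_eqI)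

lemma blpow_0: "blpow T 0 = id_blinfun"
  by (simp add: blpow_def)

lemma blpow_Suc: "blpow T (Suc n) = T o\<^sub>L blpow T n"
  by (simp add: blpow_def)

lemma blpow_commute: "A o\<^sub>L T = T o\<^sub>L A \<Longrightarrow> blpow T n o\<^sub>L A = A o\<^sub>L blpow T n"
proof (induction n)
  case 0
  then show ?case by (simp add: blpow_0)
next
  case (Suc n)
  then show ?case by (metis blpow_Suc blinfun_compose_assoc)
qed

lemma blpow_Suc_right: "blpow T (Suc n) = blpow T n o\<^sub>L T"
  by (simp add: blpow_Suc blpow_commute)

lemma blpow_add: "blpow T (m + n) = blpow T m o\<^sub>L blpow T n"
proof (induction m)
  case 0
  then show ?case by (simp add: blpow_0)
next
  case (Suc m)
  then show ?case by (simp add: blpow_Suc blinfun_compose_assoc)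
qed

section \<open>A Katznelson-Tzafriri theorem for asymptotic orbits\<close>

text \<open>The resolvent is locally bounded: \<open>R w = R v + (v - w) R v R w\<close>, so
  \<open>norm (R w) \<le> 2 * norm (R v)\<close> once \<open>|v - w| * norm (R v) \<le> 1/2\<close>.
  A finite subcover gives a uniform bound.\<close>

lemma resolvent_bounded_on_compact:
  fixes T :: "'a::complex_normed_vector \<Rightarrow>\<^sub>L 'a"
  assumes "compact K" and disj: "K \<inter> cspectrum T = {}"
  obtains B where "\<And>w. w \<in> K \<Longrightarrow> \<exists>S. norm S \<le> B \<and> (\<forall>x. blinfun_apply S (scaleC w x - T x) = x)"
proof -
  have "\<forall>w\<in>K. \<exists>S. (\<forall>x. blinfun_apply S (scaleC w x - T x) = x) \<and>
      (\<forall>x. scaleC w (blinfun_apply S x) - T (blinfun_apply S x) = x)"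
    using disj unfolding cspectrum_def by blast
  then obtain R where R1: "\<And>w x. w \<in> K \<Longrightarrow> blinfun_apply (R w) (scaleC w x - T x) = x"
    and R2: "\<And>w x. w \<in> K \<Longrightarrow> scaleC w (blinfun_apply (R w) x) - T (blinfun_apply (R w) x) = x"
    by metis
  \<comment> \<open>The radius yields the factor 1/2 needed for absorption; adding 1 keeps the
    denominator positive.\<close>
  define d where "d = (\<lambda>w. 1 / (2 * (norm (R w) + 1)))"
  have d: "0 < d w" for w
    by (simp add: d_def add_nonneg_pos)
  have local_bound: "norm (R w) \<le> 2 * norm (R v)" if "w \<in> K" "v \<in> K" "w \<in> ball v (d v)" for w v
  proof -
    have dist: "norm (v - w) * norm (R v) \<le> 1 / 2"
    proof -
      have "norm (v - w) * norm (R v) \<le> d v * (norm (R v) + 1)"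
        using that(3) d[of v] by (intro mult_mono) (auto simp: dist_norm)
      also have "\<dots> = 1 / 2"
        using add_nonneg_pos[OF norm_ge_zero zero_less_one, of "R v"] by (simp add: d_def)
      finally show ?thesis .
    qed
    have "norm (R w) \<le> norm (R v) + 1 / 2 * norm (R w)"
    proof (rule norm_blinfun_bound)
      fix x
      have "blinfun_apply (R w) x = R v (scaleC v (R w x) - T (R w x))"
        using R1[OF that(2)] by simp
      also have "scaleC v (R w x) - T (R w x)
        = (scaleC w (R w x) - T (R w x)) + scaleC (v - w) (R w x)"
        by (simp add: scaleC_left.diff)
      also have "\<dots> = x + scaleC (v - w) (R w x)"
        using R2[OF that(1)] by simp
      finally have "norm (blinfun_apply (R w) x) \<le> norm (R v x) + norm (R v (scaleC (v - w) (R w x)))"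
        using norm_triangle_ineq[of "R v x" "R v (scaleC (v - w) (R w x))"]
        by (simp add: blinfun.add_right)
      also have "\<dots> \<le> norm (R v) * norm x + norm (R v) * (norm (v - w) * (norm (R w) * norm x))"
      proof (rule add_mono[OF norm_blinfun])
        have "norm (scaleC (v - w) (R w x)) \<le> norm (v - w) * (norm (R w) * norm x)"
          unfolding norm_scaleC by (intro mult_left_mono norm_blinfun) auto
        then show "norm (R v (scaleC (v - w) (R w x))) \<le> norm (R v) * (norm (v - w) * (norm (R w) * norm x))"
          by (intro order_trans[OF norm_blinfun] mult_left_mono) auto
      qed
      also have "\<dots> = norm (R v) * norm x + (norm (v - w) * norm (R v)) * (norm (R w) * norm x)"
        by (simp add: mult_ac)
      also have "\<dots> \<le> norm (R v) * norm x + 1 / 2 * (norm (R w) * norm x)"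
        by (intro add_left_mono mult_right_mono dist) auto
      finally show "norm (blinfun_apply (R w) x) \<le> (norm (R v) + 1 / 2 * norm (R w)) * norm x"
        by (simp add: algebra_simps)
    qed simp
    then show ?thesis by simp
  qed
  have "K \<subseteq> (\<Union>w\<in>K. ball w (d w))"
    using d by auto
  from compactE_image[OF assms(1) _ this] obtain D where
    D: "D \<subseteq> K" "finite D" "K \<subseteq> (\<Union>w\<in>D. ball w (d w))"
    by auto
  show thesis
  proof
    fix w assume w: "w \<in> K"
    with D obtain v where v: "v \<in> D" "w \<in> ball v (d v)" by auto
    have "norm (R w) \<le> 2 * norm (R v)"
      using local_bound w v D by blast
    also have "\<dots> \<le> (\<Sum>v\<in>D. 2 * norm (R v))"
      using D v by (intro member_le_sum) auto
    finally show "\<exists>S. norm S \<le> (\<Sum>v\<in>D. 2 * norm (R v)) \<and> (\<forall>x. blinfun_apply S (scaleC w x - T x) = x)"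
      using R1[OF w] by blast
  qed
qed

text \<open>Applying \<open>w - T\<close> telescopes the sum, and \<open>S\<close> undoes that. The
  closed form has two terms however large \<open>n\<close> is, hence bounds independent of
  \<open>n\<close>.\<close>

lemma geometric_sum_via_left_inverse:
  fixes S T A :: "'a::complex_normed_vector \<Rightarrow>\<^sub>L 'a"
  assumes T: "clinear_op T" and S: "\<And>x. blinfun_apply S (scaleC w x - T x) = x" and w: "w \<noteq> 0"
  shows "(\<Sum>i<n. scaleC (inverse w ^ i) (blpow T i o\<^sub>L A))
    = S o\<^sub>L scaleC w (A - scaleC (inverse w ^ n) (blpow T n o\<^sub>L A))" (is "?P n = _")
proof (rule blinfun_eqI)
  fix x
  have Tc: "T (scaleC c y) = scaleC c (T y)" for c y
    using T by (simp add: clinear_op_def)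
  have "scaleC w (?P n x) - T (?P n x) = scaleC w (A x - scaleC (inverse w ^ n) (blpow T n (A x)))"
  proof (induction n)
    case 0
    then show ?case
      by (simp add: blpow_0 scaleC_one scaleC_right.zero blinfun.zero_right)
  next
    case (Suc n)
    let ?y = "blpow T n (A x)"
    have "w * inverse w ^ Suc n = inverse w ^ n" using w by simp
    then have 1: "scaleC w (scaleC (inverse w ^ Suc n) (T ?y)) = scaleC (inverse w ^ n) (T ?y)"
      by (simp only: scaleC_scaleC)
    have 2: "?P (Suc n) x = ?P n x + scaleC (inverse w ^ n) ?y"
      by (simp add: blinfun.add_left scaleC_blinfun.rep_eq)
    have "scaleC w (?P (Suc n) x) - T (?P (Suc n) x)
      = (scaleC w (?P n x) - T (?P n x)) + scaleC w (scaleC (inverse w ^ n) ?y) - scaleC (inverse w ^ n) (T ?y)"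
      unfolding 2 by (simp add: blinfun.add_right scaleC_add_right Tc)
    also have "\<dots> = scaleC w (A x) - scaleC w (scaleC (inverse w ^ Suc n) (T ?y))"
      unfolding Suc 1 by (simp add: scaleC_right.diff)
    finally show ?case by (simp add: scaleC_right.diff blpow_Suc)
  qed
  then show "?P n x = (S o\<^sub>L scaleC w (A - scaleC (inverse w ^ n) (blpow T n o\<^sub>L A))) x"
    using S[of "?P n x"] by (simp add: scaleC_blinfun.rep_eq blinfun.diff_left)
qed

text \<open>\<open>M\<close> need only be asymptotically an orbit of \<open>T\<close>. For
  power-bounded \<open>T\<close> and \<open>M n = blpow T n\<close> the hypothesis
  \<open>orbit\<close> is trivial, and the conclusion is the classical Katznelson-Tzafriri theorem
  on consecutive powers.\<close>

theorem katznelson_tzafriri_asymptotic_orbit: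
  fixes T :: "'a::complex_normed_vector \<Rightarrow>\<^sub>L 'a" and M :: "nat \<Rightarrow> 'a \<Rightarrow>\<^sub>L 'a"
  assumes T: "clinear_op T" and spec: "cspectrum T \<inter> {z. cmod z = 1} \<subseteq> {1}"
    and M: "Bseq M" and orbit: "(\<lambda>n. (T o\<^sub>L M n) - M (Suc n)) \<longlonglongrightarrow> 0"
  shows "(\<lambda>n. (T o\<^sub>L M n) - M n) \<longlonglongrightarrow> 0"
proof -
  define q where "q = (\<lambda>A::'a \<Rightarrow>\<^sub>L 'a. asymp_norm (\<lambda>n. A o\<^sub>L M n))"
  have B: "Bseq (\<lambda>n. A o\<^sub>L M n)" for A :: "'a \<Rightarrow>\<^sub>L 'a"
  proof -
    obtain c where "\<And>n. norm (M n) \<le> c" using M by (meson BseqE)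
    then have "norm (A o\<^sub>L M n) \<le> norm A * c" for n
      by (intro order_trans[OF norm_blinfun_compose] mult_left_mono) auto
    then show ?thesis by (rule BseqI')
  qed
  have q_nonneg: "0 \<le> q A" for A
    unfolding q_def by (rule asymp_norm_nonneg[OF B])
  have q_add: "q (A + A') \<le> q A + q A'" for A A'
    unfolding q_def blinfun_compose.add_left by (rule asymp_norm_add[OF B B])
  have q_scale: "q (scaleC c A) \<le> norm c * q A" for c A
    unfolding q_def scaleC_compose_left by (rule asymp_norm_mono_scaled[OF B]) (auto simp: norm_scaleC)
  have q_left: "q (S o\<^sub>L A) \<le> norm S * q A" for S A
    unfolding q_def blinfun_compose_assoc
    by (rule asymp_norm_mono_scaled[OF B]) (auto simp: norm_blinfun_compose)
  \<comment> \<open>\<open>A T M(n)\<close> and \<open>A M(n+1)\<close> differ by a null sequence,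
    and the shift does not change the asymptotic norm. Subadditivity is used once in each
    direction.\<close>
  have q_T: "q (A o\<^sub>L T) = q A" for A
  proof -
    have lim: "(\<lambda>n. A o\<^sub>L ((T o\<^sub>L M n) - M (Suc n))) \<longlonglongrightarrow> 0"
      by (rule blinfun_compose.tendsto_right_zero[OF orbit])
    have lim': "(\<lambda>n. - (A o\<^sub>L ((T o\<^sub>L M n) - M (Suc n)))) \<longlonglongrightarrow> 0"
      using tendsto_minus[OF lim] by simp
    have Suc: "Bseq (\<lambda>n. A o\<^sub>L M (Suc n))"
      using B[of A] by (simp add: Bseq_Suc_iff[of "\<lambda>n. A o\<^sub>L M n"])
    have 0: "Bseq s" if "s \<longlonglongrightarrow> 0" for s :: "nat \<Rightarrow> 'a \<Rightarrow>\<^sub>L 'a"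
      using that by (blast intro: convergentI convergent_imp_Bseq)
    have "q (A o\<^sub>L T) = asymp_norm (\<lambda>n. (A o\<^sub>L M (Suc n)) + (A o\<^sub>L ((T o\<^sub>L M n) - M (Suc n))))"
      by (simp add: q_def blinfun_compose_assoc blinfun_compose.diff_right)
    also have "\<dots> \<le> q A"
      using asymp_norm_add[OF Suc 0[OF lim]]
      by (simp add: asymp_norm_eq_0[OF lim] asymp_norm_Suc[of "\<lambda>n. A o\<^sub>L M n"] q_def)
    finally have 1: "q (A o\<^sub>L T) \<le> q A" .
    have "q A = asymp_norm (\<lambda>n. ((A o\<^sub>L T) o\<^sub>L M n) + - (A o\<^sub>L ((T o\<^sub>L M n) - M (Suc n))))"
      by (simp add: q_def blinfun_compose_assoc blinfun_compose.diff_right asymp_norm_Suc[of "\<lambda>n. A o\<^sub>L M n"])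
    also have "\<dots> \<le> q (A o\<^sub>L T)"
      using asymp_norm_add[OF B[of "A o\<^sub>L T"] 0[OF lim']]
      by (simp add: asymp_norm_eq_0[OF lim'] q_def)
    finally show ?thesis using 1 by simp
  qed
  have q_pow: "q (A o\<^sub>L blpow T i) = q A" for A i
  proof (induction i)
    case 0
    then show ?case by (simp add: blpow_0)
  next
    case (Suc i)
    then show ?case by (simp add: blpow_Suc_right q_T flip: blinfun_compose_assoc)
  qed
  define C where "C = q id_blinfun"
  have q_u: "q (blpow T i) = C" for i
    using q_pow[of id_blinfun i] by (simp add: C_def)
  have C0: "0 \<le> C" by (simp add: C_def q_nonneg)
  \<comment> \<open>\<open>K\<close> depends on \<open>m\<close> but not on \<open>r\<close>, so
    \<open>r\<close> can tend to infinity first.\<close>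
  have main: "\<exists>K\<ge>0. \<forall>r\<ge>1. q (T - id_blinfun) \<le> 24 * C / real m + (C + 2 * K) / real (r * m)"
    if m: "m \<ge> 4" for m
  proof -
    \<comment> \<open>A closed arc of the unit circle that omits 1, hence compact and disjoint from
      the spectrum.\<close>
    let ?K = "sphere 0 1 \<inter> {w. Re w \<le> cos (pi / real m)}"
    have c1: "cos (pi / real m) < 1"
      using cos_monotone_0_pi[of 0 "pi / real m"] m by (simp add: field_simps)
    have "compact ?K"
      by (intro compact_Int_closed closed_halfspace_Re_le) simp
    moreover have "?K \<inter> cspectrum T = {}"
      using spec c1 by auto
    ultimately obtain b where b: "\<And>w. w \<in> ?K \<Longrightarrow> \<exists>S. norm S \<le> b \<and> (\<forall>x. blinfun_apply S (scaleC w x - T x) = x)"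
      using resolvent_bounded_on_compact by blast
    have far: "q (\<Sum>i<n. \<Sum>j<n. scaleC (inverse w ^ (i + j)) (blpow T (i + j))) \<le> 4 * b\<^sup>2 * C"
      if w: "norm w = 1" "Re w \<le> cos (pi / real m)" for w n
    proof -
      obtain S where Sb: "norm S \<le> b" and S: "\<And>x. blinfun_apply S (scaleC w x - T x) = x"
        using b[of w] w by auto
      have b0: "0 \<le> b" using Sb norm_ge_zero order_trans by blast
      have w0: "w \<noteq> 0" using w by auto
      \<comment> \<open>\<open>P\<close> is left multiplication by a geometric sum. The double sum
        is the square of that geometric sum, that is \<open>P (P id_blinfun)\<close>, and each
        application of \<open>P\<close> costs a factor \<open>2 * b\<close>.\<close>
      define P where "P = (\<lambda>A :: 'a \<Rightarrow>\<^sub>L 'a. \<Sum>i<n. scaleC (inverse w ^ i) (blpow T i o\<^sub>L A))"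
      \<comment> \<open>Both terms of the closed form have seminorm at most \<open>q A\<close>.
        Commutation moves the power of \<open>T\<close> to the right of \<open>A\<close>, where
        \<open>q_pow\<close> absorbs it.\<close>
      have P_le: "q (P A) \<le> 2 * b * q A" if "A o\<^sub>L T = T o\<^sub>L A" for A
      proof -
        have "q (P A) \<le> norm S * q (scaleC w (A - scaleC (inverse w ^ n) (blpow T n o\<^sub>L A)))"
          unfolding P_def geometric_sum_via_left_inverse[OF T S w0] by (rule q_left)
        also have "\<dots> \<le> b * (2 * q A)"
        proof (rule mult_mono[OF Sb])
          have "q (scaleC w (A - scaleC (inverse w ^ n) (blpow T n o\<^sub>L A)))
            \<le> q (A + scaleC (- (inverse w ^ n)) (A o\<^sub>L blpow T n))"
            using q_scale[of w "A - scaleC (inverse w ^ n) (blpow T n o\<^sub>L A)"] w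
            by (simp add: scaleC_left.minus blpow_commute[OF that])
          also have "\<dots> \<le> q A + q (scaleC (- (inverse w ^ n)) (A o\<^sub>L blpow T n))"
            by (rule q_add)
          also have "q (scaleC (- (inverse w ^ n)) (A o\<^sub>L blpow T n)) \<le> q A"
            using q_scale[of "- (inverse w ^ n)" "A o\<^sub>L blpow T n"] w
            by (simp add: norm_power norm_inverse q_pow)
          finally show "q (scaleC w (A - scaleC (inverse w ^ n) (blpow T n o\<^sub>L A))) \<le> 2 * q A"
            by simp
        qed (use b0 q_nonneg in auto)
        finally show ?thesis by simp
      qed
      have P_commute: "P A o\<^sub>L T = T o\<^sub>L P A" if "A o\<^sub>L T = T o\<^sub>L A" for A
      proof -
        have "(blpow T i o\<^sub>L A) o\<^sub>L T = T o\<^sub>L (blpow T i o\<^sub>L A)" for i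
          by (metis that blinfun_compose_assoc blpow_Suc blpow_Suc_right)
        moreover have "T o\<^sub>L scaleC c D = scaleC c (T o\<^sub>L D)" for c and D :: "'a \<Rightarrow>\<^sub>L 'a"
          using T by (intro blinfun_eqI) (simp add: scaleC_blinfun.rep_eq clinear_op_def)
        ultimately show ?thesis
          by (simp add: P_def blinfun_compose.sum_left blinfun_compose.sum_right scaleC_compose_left)
      qed
      have id: "id_blinfun o\<^sub>L T = T o\<^sub>L id_blinfun" by simp
      have "(\<Sum>i<n. \<Sum>j<n. scaleC (inverse w ^ (i + j)) (blpow T (i + j))) = P (P id_blinfun)"
      proof -
        have pc: "blpow T i (scaleC c x) = scaleC c (blpow T i x)" for i c x
          using T by (induction i) (auto simp: blpow_0 blpow_Suc clinear_op_def)
        show ?thesis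
          by (intro blinfun_eqI)
            (simp add: P_def blinfun.sum_left blinfun.sum_right scaleC_blinfun.rep_eq pc
              scaleC_right.sum scaleC_scaleC power_add blpow_add)
      qed
      then have "q (\<Sum>i<n. \<Sum>j<n. scaleC (inverse w ^ (i + j)) (blpow T (i + j))) \<le> 2 * b * q (P id_blinfun)"
        using P_le[OF P_commute[OF id]] by simp
      also have "\<dots> \<le> 2 * b * (2 * b * C)"
        unfolding C_def using b0 by (intro mult_left_mono P_le[OF id]) auto
      finally show ?thesis by (simp add: power2_eq_square)
    qed
    have "q (T - id_blinfun) \<le> 24 * C / real m + (C + 2 * (4 * b\<^sup>2 * C)) / real (r * m)" if r: "r \<ge> 1" for r
    proof -
      have "r * m \<noteq> 0" using r m by simp
      \<comment> \<open>With this \<open>k\<close> the difference of consecutive powers is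
        \<open>T - id_blinfun\<close> times \<open>blpow T k\<close>, which has the same seminorm as
        \<open>T - id_blinfun\<close>.\<close>
      then obtain k where k: "r * m = Suc k" by (cases "r * m") auto
      have "q (blpow T (r * m) - blpow T (r * m - 1)) \<le> 24 * C / real m + (C + 2 * (4 * b\<^sup>2 * C)) / real (r * m)"
        by (rule seminorm_power_difference_le[OF q_nonneg q_add q_scale _ far r m refl]) (simp_all add: q_u)
      moreover have "blpow T (r * m) - blpow T (r * m - 1) = (T - id_blinfun) o\<^sub>L blpow T k"
        by (simp add: k blpow_Suc blinfun_compose.diff_left)
      ultimately show ?thesis by (simp add: q_pow)
    qed
    then show ?thesis
      using C0 by (intro exI[of _ "4 * b\<^sup>2 * C"]) auto
  qed
  have "q (T - id_blinfun) \<le> 24 * C / real m" if m: "m \<ge> 4" for m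
  proof -
    obtain K where K: "\<And>r. r \<ge> 1 \<Longrightarrow> q (T - id_blinfun) \<le> 24 * C / real m + (C + 2 * K) / real (r * m)"
      using main[OF m] by blast
    \<comment> \<open>Letting \<open>r\<close> tend to infinity removes the resolvent term; the
      limit in \<open>m\<close> afterwards removes the rest.\<close>
    have "(\<lambda>r. 24 * C / real m + (C + 2 * K) / real m * inverse (real r)) \<longlonglongrightarrow> 24 * C / real m + (C + 2 * K) / real m * 0"
      by (intro tendsto_intros lim_inverse_n)
    then show ?thesis
      by (intro Lim_bounded2[of _ "24 * C / real m" 1]) (use K in \<open>auto simp: field_simps\<close>)
  qed
  moreover have "(\<lambda>m. 24 * C * inverse (real m)) \<longlonglongrightarrow> 24 * C * 0"
    by (intro tendsto_intros lim_inverse_n)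
  ultimately have "q (T - id_blinfun) \<le> 0"
    by (intro Lim_bounded2[of "\<lambda>m. 24 * C * inverse (real m)" 0 4]) (auto simp: field_simps)
  then have "asymp_norm (\<lambda>n. (T - id_blinfun) o\<^sub>L M n) = 0"
    using q_nonneg[of "T - id_blinfun"] by (simp add: q_def)
  from tendsto_0_if_asymp_norm_eq_0[OF B this] show ?thesis
    by (simp add: blinfun_compose.diff_left)
qed

section \<open>Cesaro means\<close>

lemma kcoef_pos: "0 < a \<Longrightarrow> 0 < kcoef a n"
  unfolding kcoef_def by (intro divide_pos_pos mult_pos_pos Gamma_real_pos) auto

lemma kcoef_Suc:
  assumes "0 < a"
  shows "kcoef a (Suc n) = kcoef a n * (real n + a) / (real n + 1)"
proof -
  have "Gamma (real n + a + 1) = (real n + a) * Gamma (real n + a)"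
    using assms by (intro Gamma_plus1) (auto elim!: nonpos_Ints_cases)
  moreover have "Gamma (real n + 1 + 1) = (real n + 1) * Gamma (real n + 1)"
    by (intro Gamma_plus1) (auto elim!: nonpos_Ints_cases)
  ultimately show ?thesis
    by (simp add: kcoef_def add_ac mult_ac)
qed

text \<open>Comes from \<open>Gamma (a + 1) = a * Gamma a\<close>; it expresses the inhomogeneous
  term of \<open>cesaro_sum_Suc\<close> through the normalising coefficient of the means.\<close>

lemma kcoef_Suc_eq_kcoef_plus1:
  assumes "0 < a"
  shows "kcoef a (Suc n) = kcoef (a + 1) n * a / (real n + 1)"
proof -
  have "Gamma (a + 1) = a * Gamma a"
    using assms by (intro Gamma_plus1) (auto elim!: nonpos_Ints_cases)
  moreover have "Gamma (real n + 1 + 1) = (real n + 1) * Gamma (real n + 1)"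
    by (intro Gamma_plus1) (auto elim!: nonpos_Ints_cases)
  ultimately show ?thesis
    using assms by (simp add: kcoef_def add_ac)
qed

text \<open>Split off the term \<open>j = 0\<close>; shifting the index in the others keeps the
  coefficient \<open>kcoef a (n - j)\<close> and pulls out one factor \<open>T\<close>.\<close>

lemma cesaro_sum_Suc:
  "cesaro_sum a T (Suc n) = (T o\<^sub>L cesaro_sum a T n) + kcoef a (Suc n) *\<^sub>R id_blinfun"
proof -
  have "cesaro_sum a T (Suc n)
    = kcoef a (Suc n) *\<^sub>R blpow T 0 + (\<Sum>j=0..n. kcoef a (Suc n - Suc j) *\<^sub>R blpow T (Suc j))"
    unfolding cesaro_sum_def by (subst sum.atLeast0_atMost_Suc_shift) simp
  also have "(\<Sum>j=0..n. kcoef a (Suc n - Suc j) *\<^sub>R blpow T (Suc j)) = T o\<^sub>L cesaro_sum a T n"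
    by (simp add: cesaro_sum_def blpow_Suc blinfun_compose.sum_right blinfun_compose.scaleR_right)
  finally show ?thesis by (simp add: blpow_0 add.commute)
qed

text \<open>Divide \<open>cesaro_sum_Suc\<close> by \<open>kcoef (a + 1) n\<close>: the two
  coefficient ratios are \<open>1 + a / (n + 1)\<close> and \<open>a / (n + 1)\<close>. So for
  bounded means the defect from being an orbit is a null factor times a bounded sequence.\<close>

lemma compose_cesaro_mean:
  assumes a: "0 < a"
  shows "(T o\<^sub>L cesaro_mean a T n) - cesaro_mean a T (Suc n)
    = (a / (real n + 1)) *\<^sub>R (cesaro_mean a T (Suc n) - id_blinfun)"
proof -
  let ?k = "kcoef (a + 1) n" and ?k' = "kcoef (a + 1) (Suc n)"
  have pos: "0 < ?k" "0 < ?k'" using a by (simp_all add: kcoef_pos)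
  have ratio: "?k' = ?k * (1 + a / (real n + 1))"
    using a kcoef_Suc[of "a + 1" n] by (simp add: field_simps)
  have k: "kcoef a (Suc n) = ?k * (a / (real n + 1))"
    using kcoef_Suc_eq_kcoef_plus1[OF a] by simp
  have "cesaro_sum a T (Suc n) = ?k' *\<^sub>R cesaro_mean a T (Suc n)"
    using pos by (simp add: cesaro_mean_def)
  moreover have "T o\<^sub>L cesaro_sum a T n = ?k *\<^sub>R (T o\<^sub>L cesaro_mean a T n)"
    using pos by (simp add: cesaro_mean_def blinfun_compose.scaleR_right)
  ultimately have "?k *\<^sub>R (T o\<^sub>L cesaro_mean a T n)
     = ?k *\<^sub>R ((1 + a / (real n + 1)) *\<^sub>R cesaro_mean a T (Suc n) - (a / (real n + 1)) *\<^sub>R id_blinfun)"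
    using cesaro_sum_Suc[of a T n] by (simp add: ratio k scaleR_right_diff_distrib eq_diff_eq)
  then have "T o\<^sub>L cesaro_mean a T n
     = (1 + a / (real n + 1)) *\<^sub>R cesaro_mean a T (Suc n) - (a / (real n + 1)) *\<^sub>R id_blinfun"
    using pos by (subst (asm) real_vector.scale_cancel_left) auto
  then show ?thesis by (simp add: scaleR_left_distrib scaleR_right_diff_distrib)
qed

theorem theorem4p1:
  fixes T :: "'a::{complex_normed_vector, banach} \<Rightarrow>\<^sub>L 'a" and a :: real
  assumes "a > 0"
    and "clinear_op T"
    and "cesaro_bounded a T"
    and "cspectrum T \<inter> {z. cmod z = 1} \<subseteq> {1}"
  shows "(\<lambda>n. norm (cesaro_mean a T (Suc n) - cesaro_mean a T n)) \<longlonglongrightarrow> 0"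
proof -
  let ?M = "cesaro_mean a T"
  have bdd: "Bseq ?M"
    using assms(3) by (auto simp: cesaro_bounded_def intro: BseqI')
  then have "Bseq (\<lambda>n. ?M (Suc n) - id_blinfun)"
    using Bseq_add[of "\<lambda>n. ?M (Suc n)" "- id_blinfun"] by (simp add: Bseq_Suc_iff)
  then have "Bfun (\<lambda>n. ?M (Suc n) - id_blinfun) sequentially" .
  moreover have "(\<lambda>n. a / (real n + 1)) \<longlonglongrightarrow> 0"
    using tendsto_mult[OF tendsto_const[of a] LIMSEQ_inverse_real_of_nat] by (simp add: field_simps)
  ultimately have orbit: "(\<lambda>n. (T o\<^sub>L ?M n) - ?M (Suc n)) \<longlonglongrightarrow> 0"
    unfolding compose_cesaro_mean[OF assms(1)]
    by (simp add: tendsto_Zfun_iff bounded_bilinear.Zfun_prod_Bfun[OF bounded_bilinear_scaleR])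
  \<comment> \<open>Both brackets are null sequences, and \<open>T M(n)\<close> cancels in their
    difference, leaving \<open>M(n+1) - M(n)\<close>.\<close>
  have "(\<lambda>n. ((T o\<^sub>L ?M n) - ?M n) - ((T o\<^sub>L ?M n) - ?M (Suc n))) \<longlonglongrightarrow> 0 - 0"
    by (intro tendsto_diff orbit katznelson_tzafriri_asymptotic_orbit assms(2,4) bdd)
  then show ?thesis
    by (intro tendsto_norm_zero) simp
qed

end
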